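(* It is not true that for all positive semidefinite matrices $B,\Delta$ (of equal size), all unitarily invariant norms $|||\cdot|||$, and all non-negative increasing convex functions $g:[0,\infty)\to\mathbb{R}$ with $g(0)=0$, the inequality $|||g(B+\Delta)-g(B)|||\ge|||g(\Delta)|||$ holds. That is, there exist $n\in\mathbb{N}$, $n\times n$ complex positive semidefinite matrices $B,\Delta$, a unitarily invariant norm $|||\cdot|||$ on the $n\times n$ complex matrices, and a non-negative increasing convex function $g:[0,\infty)\to\mathbb{R}$ with $g(0)=0$ such that $|||g(B+\Delta)-g(B)|||<|||g(\Delta)|||$.
   Context: A norm on $n\times n$ complex matrices is unitarily invariant if $|||UXV|||=|||X|||$ for all matrices $X$ and all unitary $U,V$. For a positive semidefinite matrix $X$, $g(X)$ is defined by the spectral functional calculus. *)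

theory Defs
  imports Complex_Main "HOL-Analysis.Convex" "Jordan_Normal_Form.Schur_Decomposition"
begin

definition unitary_mat :: "nat \<Rightarrow> complex mat \<Rightarrow> bool" where
  "unitary_mat n U \<longleftrightarrow>
     U \<in> carrier_mat n n \<and> U * mat_adjoint U = 1\<^sub>m n \<and> mat_adjoint U * U = 1\<^sub>m n"

definition psd_mat :: "nat \<Rightarrow> complex mat \<Rightarrow> bool" where
  "psd_mat n X \<longleftrightarrow>
     X \<in> carrier_mat n n \<and> mat_adjoint X = X \<and>
     (\<forall>v \<in> carrier_vec n. 0 \<le> Re ((X *\<^sub>v v) \<bullet>c v))"

(* Only the values of the function on n x n matrices are constrained. *)
definition matrix_norm :: "nat \<Rightarrow> (complex mat \<Rightarrow> real) \<Rightarrow> bool" where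
  "matrix_norm n N \<longleftrightarrow>
     (\<forall>X \<in> carrier_mat n n. 0 \<le> N X) \<and>
     (\<forall>X \<in> carrier_mat n n. N X = 0 \<longleftrightarrow> X = 0\<^sub>m n n) \<and>
     (\<forall>X \<in> carrier_mat n n. \<forall>c. N (c \<cdot>\<^sub>m X) = cmod c * N X) \<and>
     (\<forall>X \<in> carrier_mat n n. \<forall>Y \<in> carrier_mat n n. N (X + Y) \<le> N X + N Y)"

definition unitarily_invariant_norm :: "nat \<Rightarrow> (complex mat \<Rightarrow> real) \<Rightarrow> bool" where
  "unitarily_invariant_norm n N \<longleftrightarrow>
     matrix_norm n N \<and>
     (\<forall>X \<in> carrier_mat n n. \<forall>U V. unitary_mat n U \<longrightarrow> unitary_mat n V \<longrightarrow> N (U * X * V) = N X)"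

definition spectral_calculus_rel ::
    "nat \<Rightarrow> (real \<Rightarrow> real) \<Rightarrow> complex mat \<Rightarrow> complex mat \<Rightarrow> bool" where
  "spectral_calculus_rel n g X Y \<longleftrightarrow>
     (\<exists>U d. unitary_mat n U \<and>
        X = U * mat_diag n (\<lambda>i. complex_of_real (d i)) * mat_adjoint U \<and>
        Y = U * mat_diag n (\<lambda>i. complex_of_real (g (d i))) * mat_adjoint U)"

(* For Hermitian X a unitary diagonalisation with real d exists by the spectral theorem, and the
   result does not depend on which one is taken (spectral_calculus_eqI below). For X positive
   semidefinite only the values of g on [0, oo) matter. *)
definition spectral_calculus :: "(real \<Rightarrow> real) \<Rightarrow> complex mat \<Rightarrow> complex mat" where
  "spectral_calculus g X = (THE Y. spectral_calculus_rel (dim_row X) g X Y)"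

lemma mat_adjoint_carrier [simp, intro]:
  "A \<in> carrier_mat n m \<Longrightarrow> mat_adjoint A \<in> carrier_mat m n"
  by (auto simp: mat_adjoint_def)

lemma spectral_calculus_rel_unique:
  assumes "spectral_calculus_rel n g X Y" "spectral_calculus_rel n g X Z"
  shows "Y = Z"
proof -
  define D :: "(nat \<Rightarrow> real) \<Rightarrow> complex mat"
    where "D = (\<lambda>d. mat_diag n (\<lambda>i. complex_of_real (d i)))"
  have D [simp]: "D d \<in> carrier_mat n n" for d by (simp add: D_def)
  obtain U d where U: "unitary_mat n U" "X = U * D d * mat_adjoint U"
      "Y = U * D (\<lambda>i. g (d i)) * mat_adjoint U"
    using assms(1) unfolding spectral_calculus_rel_def D_def by blast
  obtain V e where V: "unitary_mat n V" "X = V * D e * mat_adjoint V"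
      "Z = V * D (\<lambda>i. g (e i)) * mat_adjoint V"
    using assms(2) unfolding spectral_calculus_rel_def D_def by blast
  define U' V' where "U' = mat_adjoint U" and "V' = mat_adjoint V"
  have UU: "U \<in> carrier_mat n n" "U' \<in> carrier_mat n n" "U * U' = 1\<^sub>m n" "U' * U = 1\<^sub>m n"
    using U(1) by (auto simp: unitary_mat_def U'_def)
  have VV: "V \<in> carrier_mat n n" "V' \<in> carrier_mat n n" "V * V' = 1\<^sub>m n" "V' * V = 1\<^sub>m n"
    using V(1) by (auto simp: unitary_mat_def V'_def)
  define W where "W = V' * U"
  have W: "W \<in> carrier_mat n n" using UU VV by (simp add: W_def)
  have left: "V' * (U * M * U') * U = W * M" if M: "M \<in> carrier_mat n n" for M
  proof -
    have "V' * (U * M * U') * U = V' * (U * M * (U' * U))"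
      using UU(1,2) VV(1,2) M by (simp add: assoc_mult_mat[of _ n n _ n _ n])
    also have "\<dots> = W * M"
      using UU VV(1,2) M by (simp add: W_def assoc_mult_mat[of _ n n _ n _ n])
    finally show ?thesis .
  qed
  have right: "V' * (V * M * V') * U = M * W" if M: "M \<in> carrier_mat n n" for M
  proof -
    have "V' * (V * M * V') * U = (V' * V) * (M * (V' * U))"
      using UU(1,2) VV(1,2) M by (simp add: assoc_mult_mat[of _ n n _ n _ n])
    also have "\<dots> = M * W"
      using VV UU(1,2) M W by (simp add: W_def)
    finally show ?thesis .
  qed
  have WDe: "W * D d = D e * W"
    using left[OF D, of d] right[OF D, of e] U(2) V(2) unfolding U'_def V'_def by metis
  have WD: "(W * D h) $$ (i, j) = W $$ (i, j) * of_real (h j)"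
    if "i < n" "j < n" for h i j
    using that W by (simp add: D_def mat_diag_mult_right[OF W] mult.commute)
  have DW: "(D h * W) $$ (i, j) = of_real (h i) * W $$ (i, j)"
    if "i < n" "j < n" for h i j
    using that W by (simp add: D_def mat_diag_mult_left[OF W])
  have ij: "W $$ (i, j) = 0 \<or> d j = e i" if "i < n" "j < n" for i j
  proof -
    have "W $$ (i, j) * complex_of_real (d j) = complex_of_real (e i) * W $$ (i, j)"
      by (simp only: WD[OF that, symmetric] DW[OF that, symmetric] WDe)
    thus ?thesis by (auto simp: mult.commute)
  qed
  have gW: "W * D (\<lambda>i. g (d i)) = D (\<lambda>i. g (e i)) * W"
  proof (rule eq_matI)
    fix i j
    assume "i < dim_row (D (\<lambda>i. g (e i)) * W)" "j < dim_col (D (\<lambda>i. g (e i)) * W)"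
    hence "i < n" "j < n" using W carrier_matD[OF D, of "\<lambda>i. g (e i)"] by auto
    thus "(W * D (\<lambda>i. g (d i))) $$ (i, j) = (D (\<lambda>i. g (e i)) * W) $$ (i, j)"
      using ij[of i j] by (auto simp: WD DW)
  qed (use W carrier_matD[OF D] in auto)
  have Y: "Y = U * D (\<lambda>i. g (d i)) * U'" and Z: "Z = V * D (\<lambda>i. g (e i)) * V'"
    using U(3) V(3) unfolding U'_def V'_def .
  have eq: "V' * Y * U = V' * Z * U"
    unfolding Y Z left[OF D] right[OF D] by (rule gW)
  have YZ: "Y \<in> carrier_mat n n" "Z \<in> carrier_mat n n"
    unfolding Y Z by (rule mult_carrier_mat[OF mult_carrier_mat[OF UU(1) D] UU(2)],
                      rule mult_carrier_mat[OF mult_carrier_mat[OF VV(1) D] VV(2)])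
  have cancel: "V * (V' * M * U) * U' = M" if M: "M \<in> carrier_mat n n" for M
  proof -
    have "V * (V' * M * U) * U' = (V * V') * (M * (U * U'))"
      using UU(1,2) VV(1,2) M by (simp add: assoc_mult_mat[of _ n n _ n _ n])
    also have "\<dots> = M" using UU VV M by simp
    finally show ?thesis .
  qed
  show ?thesis using eq cancel[OF YZ(1)] cancel[OF YZ(2)] by metis
qed

lemma spectral_calculus_eqI:
  assumes "unitary_mat n U"
    and "X = U * mat_diag n (\<lambda>i. complex_of_real (d i)) * mat_adjoint U"
  shows "spectral_calculus g X =
    U * mat_diag n (\<lambda>i. complex_of_real (g (d i))) * mat_adjoint U"
proof -
  have "dim_row X = n"
    using assms by (auto simp: unitary_mat_def)
  moreover have "spectral_calculus_rel n g X
      (U * mat_diag n (\<lambda>i. complex_of_real (g (d i))) * mat_adjoint U)"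
    using assms unfolding spectral_calculus_rel_def by blast
  ultimately show ?thesis
    unfolding spectral_calculus_def using spectral_calculus_rel_unique
    by (intro the_equality) simp_all
qed

end

(* In the operator norm, convexity of g is not enough because the positive part x_+ is not operator
   monotone.  Take hermitian A and D >= 0 such that the top eigenvector v of D satisfies
   <v, ((A + D)_+ - A_+) v> < 0.  With B = A + c, where c is at least the norms of A_- and D, and
   g(x) = alpha x + (x - c)_+, one gets g(D) = alpha D, whereas
   g(B + D) - g(B) = alpha D + ((A + D)_+ - A_+) has strictly smaller norm once alpha is so large
   that the second-order effect of the off-diagonal terms is negligible.  Below c = 154, alpha = 10,
   D = diag(49, 0, 35), and A has eigenvalues 50, -154, -35.

   Given rational orthogonal eigenbases of A and of A + D, the requirement that D be diagonal
   is a system of three linear equations in the six eigenvalues; it always has a solution other than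
   the scalar shifts, so that all data can be rational. *)
theory Submission
  imports Defs
begin

section \<open>Euclidean norm and adjoints\<close>

text \<open>Expressed through \<open>L2_set\<close>, so that Minkowski's inequality gives the
  triangle inequality.\<close>

definition vnorm :: "complex vec \<Rightarrow> real" where
  "vnorm v = L2_set (\<lambda>i. cmod (v $ i)) {..<dim_vec v}"

lemma vnorm_sq: "(vnorm v)\<^sup>2 = (\<Sum>i<dim_vec v. (cmod (v $ i))\<^sup>2)"
  by (simp add: vnorm_def L2_set_def sum_nonneg)

text \<open>Turns claims about lengths into claims about inner products, where adjoints can be moved
  across.\<close>

lemma vnorm_sq_cscalar_prod: "complex_of_real ((vnorm v)\<^sup>2) = v \<bullet>c v"
  by (simp add: vnorm_sq scalar_prod_def lessThan_atLeast0
      complex_norm_square[unfolded of_real_power])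

lemma vnorm_nonneg [simp]: "0 \<le> vnorm v"
  by (simp add: vnorm_def)

lemma vnorm_zero [simp]: "vnorm (0\<^sub>v n) = 0"
  by (simp add: vnorm_def L2_set_def)

lemma vnorm_eq_0_iff:
  assumes "v \<in> carrier_vec n"
  shows "vnorm v = 0 \<longleftrightarrow> v = 0\<^sub>v n"
  using assms by (auto simp: vnorm_def L2_set_eq_0_iff)

lemma vnorm_smult: "vnorm (c \<cdot>\<^sub>v v) = cmod c * vnorm v"
proof -
  have "vnorm (c \<cdot>\<^sub>v v) = L2_set (\<lambda>i. cmod c * cmod (v $ i)) {..<dim_vec v}"
    by (auto simp: vnorm_def norm_mult intro!: L2_set_cong)
  thus ?thesis
    by (simp add: vnorm_def L2_set_right_distrib)
qed

lemma vnorm_add_le: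
  assumes "v \<in> carrier_vec n" "w \<in> carrier_vec n"
  shows "vnorm (v + w) \<le> vnorm v + vnorm w"
proof -
  have "vnorm (v + w) = L2_set (\<lambda>i. cmod (v $ i + w $ i)) {..<n}"
    using assms by (auto simp: vnorm_def intro!: L2_set_cong)
  also have "\<dots> \<le> L2_set (\<lambda>i. cmod (v $ i) + cmod (w $ i)) {..<n}"
    by (intro L2_set_mono) (auto intro: norm_triangle_ineq)
  also have "\<dots> \<le> L2_set (\<lambda>i. cmod (v $ i)) {..<n} + L2_set (\<lambda>i. cmod (w $ i)) {..<n}"
    by (rule L2_set_triangle_ineq)
  finally show ?thesis
    using assms by (simp add: vnorm_def)
qed

lemma vnorm_unit_vec: "i < n \<Longrightarrow> vnorm (unit_vec n i) = 1"
  by (simp add: vnorm_def L2_set_def if_distrib[of cmod] if_distrib[of "\<lambda>x. x\<^sup>2"] cong: if_cong)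

section \<open>Adjoints, unitary matrices and positive semidefiniteness\<close>

lemma mat_adjoint_index [simp]:
  assumes "A \<in> carrier_mat n m" "i < m" "j < n"
  shows "mat_adjoint A $$ (i, j) = cnj (A $$ (j, i))"
  using assms by (simp add: mat_adjoint_def mat_of_rows_def)

lemma mat_adjoint_adjoint:
  fixes A :: "complex mat"
  assumes "A \<in> carrier_mat n m"
  shows "mat_adjoint (mat_adjoint A) = A"
proof (rule eq_matI)
  fix i j assume "i < dim_row A" "j < dim_col A"
  thus "mat_adjoint (mat_adjoint A) $$ (i, j) = A $$ (i, j)"
    using assms by (simp add: mat_adjoint_index[of _ m n])
qed (use assms in \<open>auto simp: mat_adjoint_def\<close>)

lemma mult_mat_vec_cscalar_prod:
  fixes A :: "complex mat"
  assumes A: "A \<in> carrier_mat n m" and v: "v \<in> carrier_vec m" and w: "w \<in> carrier_vec n"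
  shows "(A *\<^sub>v v) \<bullet>c w = v \<bullet>c (mat_adjoint A *\<^sub>v w)"
proof -
  have "(A *\<^sub>v v) \<bullet>c w = (\<Sum>i<n. \<Sum>j<m. A $$ (i, j) * v $ j * cnj (w $ i))"
    using A v w by (simp add: scalar_prod_def lessThan_atLeast0 sum_distrib_right)
  also have "\<dots> = (\<Sum>j<m. \<Sum>i<n. A $$ (i, j) * v $ j * cnj (w $ i))"
    by (rule sum.swap)
  also have "\<dots> = v \<bullet>c (mat_adjoint A *\<^sub>v w)"
    using A v w carrier_matD[OF mat_adjoint_carrier[OF A]]
    by (simp add: scalar_prod_def lessThan_atLeast0 sum_distrib_left mult_ac
        mat_adjoint_index[OF A])
  finally show ?thesis .
qed

lemma unitary_mat_adjoint: "unitary_mat n U \<Longrightarrow> unitary_mat n (mat_adjoint U)"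
  by (auto simp: unitary_mat_def mat_adjoint_adjoint)

text \<open>Moving \<open>U\<close> across the inner product produces
  \<open>mat_adjoint U * U\<close>, which is the identity.\<close>

lemma vnorm_unitary_mat:
  assumes U: "unitary_mat n U" and v: "v \<in> carrier_vec n"
  shows "vnorm (U *\<^sub>v v) = vnorm v"
proof -
  have Uc: "U \<in> carrier_mat n n" and UU: "mat_adjoint U * U = 1\<^sub>m n"
    using U by (auto simp: unitary_mat_def)
  have "(U *\<^sub>v v) \<bullet>c (U *\<^sub>v v) = v \<bullet>c (mat_adjoint U *\<^sub>v (U *\<^sub>v v))"
    using Uc v by (intro mult_mat_vec_cscalar_prod) auto
  also have "mat_adjoint U *\<^sub>v (U *\<^sub>v v) = v"
    using Uc v UU by (simp flip: assoc_mult_mat_vec[of _ n n _ n])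
  finally have "(vnorm (U *\<^sub>v v))\<^sup>2 = (vnorm v)\<^sup>2"
    by (metis vnorm_sq_cscalar_prod of_real_eq_iff)
  thus ?thesis by simp
qed

text \<open>In the coordinates \<open>w = mat_adjoint U *\<^sub>v v\<close> the quadratic form is
  the sum of \<open>d i\<close> times the squared modulus of \<open>w $ i\<close>.\<close>

lemma psd_mat_unitary_diag:
  assumes U: "unitary_mat n U" and d: "\<And>i. i < n \<Longrightarrow> 0 \<le> d i"
  shows "psd_mat n (U * mat_diag n (\<lambda>i. complex_of_real (d i)) * mat_adjoint U)"
    (is "psd_mat n (U * ?D * _)")
  unfolding psd_mat_def
proof (intro conjI ballI)
  have Uc: "U \<in> carrier_mat n n" using U by (simp add: unitary_mat_def)
  let ?X = "U * ?D * mat_adjoint U"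
  have Xc: "?X \<in> carrier_mat n n"
    using Uc by (meson mult_carrier_mat mat_diag_dim mat_adjoint_carrier)
  show "?X \<in> carrier_mat n n" by (rule Xc)
  \<comment> \<open>Since \<open>d\<close> is real, exchanging \<open>i\<close> and \<open>j\<close>
    in this formula amounts to conjugation, so the matrix is Hermitian.\<close>
  have X_index: "?X $$ (i, j) = (\<Sum>k<n. U $$ (i, k) * of_real (d k) * cnj (U $$ (j, k)))"
    if "i < n" "j < n" for i j
    using that Uc carrier_matD[OF mat_adjoint_carrier[OF Uc]]
    by (simp add: mat_adjoint_index[OF Uc] mat_diag_mult_right[OF Uc] scalar_prod_def
        lessThan_atLeast0 mult_ac)
  show "mat_adjoint ?X = ?X"
  proof (rule eq_matI)
    fix i j assume "i < dim_row ?X" "j < dim_col ?X"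
    hence ij: "i < n" "j < n" using carrier_matD[OF Xc] by auto
    show "mat_adjoint ?X $$ (i, j) = ?X $$ (i, j)"
      unfolding mat_adjoint_index[OF Xc ij] X_index[OF ij] X_index[OF ij(2,1)]
      by (simp add: mult_ac)
  qed (use Xc in \<open>auto simp: mat_adjoint_def\<close>)
  fix v :: "complex vec" assume v: "v \<in> carrier_vec n"
  define w where "w = mat_adjoint U *\<^sub>v v"
  have w: "w \<in> carrier_vec n" using Uc v by (auto simp: w_def intro!: mult_mat_vec_carrier)
  have Dw: "?D *\<^sub>v w \<in> carrier_vec n"
    by (rule mult_mat_vec_carrier[OF mat_diag_dim w])
  have "?X *\<^sub>v v = (U * ?D) *\<^sub>v w"
    unfolding w_def
    by (rule assoc_mult_mat_vec[OF mult_carrier_mat[OF Uc mat_diag_dim]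
          mat_adjoint_carrier[OF Uc] v])
  also have "\<dots> = U *\<^sub>v (?D *\<^sub>v w)"
    by (rule assoc_mult_mat_vec[OF Uc mat_diag_dim w])
  finally have "?X *\<^sub>v v = U *\<^sub>v (?D *\<^sub>v w)" .
  hence "(?X *\<^sub>v v) \<bullet>c v = (?D *\<^sub>v w) \<bullet>c w"
    using mult_mat_vec_cscalar_prod[OF Uc Dw v] by (simp add: w_def)
  also have "\<dots> = (\<Sum>i<n. of_real (d i) * (w $ i * cnj (w $ i)))"
  proof -
    have "(?D *\<^sub>v w) $ i = of_real (d i) * w $ i" if "i < n" for i
      using that w
      by (simp add: scalar_prod_def mat_diag_def if_distrib[of "\<lambda>x. x * _"] cong: if_cong)
    thus ?thesis
      using w by (simp add: scalar_prod_def lessThan_atLeast0 mult_ac del: index_mult_mat_vec)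
  qed
  also have "\<dots> = of_real (\<Sum>i<n. d i * (cmod (w $ i))\<^sup>2)"
    by (simp add: complex_norm_square[unfolded of_real_power])
  finally have eq: "(?X *\<^sub>v v) \<bullet>c v = of_real (\<Sum>i<n. d i * (cmod (w $ i))\<^sup>2)" .
  show "0 \<le> Re ((?X *\<^sub>v v) \<bullet>c v)"
    unfolding eq Re_complex_of_real using d by (intro sum_nonneg mult_nonneg_nonneg) auto
qed

section \<open>The operator norm\<close>

text \<open>The closed ball contains \<open>0\<^sub>v n\<close> for every \<open>n\<close>,
  including \<open>n = 0\<close>, so the supremum is never over the empty set.\<close>

definition op_norm :: "nat \<Rightarrow> complex mat \<Rightarrow> real" where
  "op_norm n X = (SUP v\<in>{v \<in> carrier_vec n. vnorm v \<le> 1}. vnorm (X *\<^sub>v v))"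

text \<open>Makes the real supremum meaningful. The sum of the moduli of all entries is a crude
  bound, because a vector in the unit ball has entries of modulus at most 1.\<close>

lemma op_norm_bdd_above:
  assumes X: "X \<in> carrier_mat n n"
  shows "bdd_above ((\<lambda>v. vnorm (X *\<^sub>v v)) ` {v \<in> carrier_vec n. vnorm v \<le> 1})"
proof (rule bdd_aboveI2)
  fix v assume "v \<in> {v \<in> carrier_vec n. vnorm v \<le> 1}"
  hence v: "v \<in> carrier_vec n" "vnorm v \<le> 1" by auto
  have le1: "cmod (v $ j) \<le> 1" if "j < n" for j
    using member_le_L2_set[of "{..<n}" j "\<lambda>i. cmod (v $ i)"] that v by (simp add: vnorm_def)
  have "vnorm (X *\<^sub>v v) \<le> (\<Sum>i<n. cmod ((X *\<^sub>v v) $ i))"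
    using X L2_set_le_sum[of "{..<n}" "\<lambda>i. cmod ((X *\<^sub>v v) $ i)"]
    by (simp add: vnorm_def del: index_mult_mat_vec)
  also have "\<dots> = (\<Sum>i<n. cmod (\<Sum>j<n. X $$ (i, j) * v $ j))"
    using X v by (simp add: scalar_prod_def lessThan_atLeast0)
  also have "\<dots> \<le> (\<Sum>i<n. \<Sum>j<n. cmod (X $$ (i, j)))"
    by (intro sum_mono order_trans[OF norm_sum])
       (use le1 in \<open>simp add: norm_mult mult_left_le\<close>)
  finally show "vnorm (X *\<^sub>v v) \<le> (\<Sum>i<n. \<Sum>j<n. cmod (X $$ (i, j)))" .
qed

lemma vnorm_le_op_norm:
  assumes "X \<in> carrier_mat n n" "v \<in> carrier_vec n" "vnorm v \<le> 1"
  shows "vnorm (X *\<^sub>v v) \<le> op_norm n X"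
  unfolding op_norm_def using assms by (intro cSUP_upper op_norm_bdd_above) auto

lemma op_norm_le:
  assumes "\<And>v. v \<in> carrier_vec n \<Longrightarrow> vnorm v \<le> 1 \<Longrightarrow> vnorm (X *\<^sub>v v) \<le> b"
  shows "op_norm n X \<le> b"
proof -
  have "0\<^sub>v n \<in> {v \<in> carrier_vec n. vnorm v \<le> 1}" by simp
  thus ?thesis
    unfolding op_norm_def using assms by (intro cSUP_least) blast+
qed

lemma op_norm_nonneg: "X \<in> carrier_mat n n \<Longrightarrow> 0 \<le> op_norm n X"
  using vnorm_le_op_norm[of X n "0\<^sub>v n"] by (simp add: order_trans[OF vnorm_nonneg])

section \<open>Norm axioms and unitary invariance of the operator norm\<close>

lemma op_norm_eq_0_iff:
  assumes X: "X \<in> carrier_mat n n"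
  shows "op_norm n X = 0 \<longleftrightarrow> X = 0\<^sub>m n n"
proof
  assume 0: "op_norm n X = 0"
  \<comment> \<open>Testing on the unit vectors shows that every column vanishes.\<close>
  have col: "col X j = 0\<^sub>v n" if j: "j < n" for j
  proof -
    have "vnorm (X *\<^sub>v unit_vec n j) \<le> 0"
      using vnorm_le_op_norm[OF X, of "unit_vec n j"] vnorm_unit_vec[OF j] 0 by simp
    hence "vnorm (X *\<^sub>v unit_vec n j) = 0"
      using vnorm_nonneg by (rule antisym)
    moreover have "X *\<^sub>v unit_vec n j = col X j"
      using X j by (intro eq_vecI) auto
    ultimately show ?thesis
      using X vnorm_eq_0_iff[of "col X j" n] by auto
  qed
  show "X = 0\<^sub>m n n"
  proof (rule eq_matI)
    fix i j assume "i < dim_row (0\<^sub>m n n :: complex mat)" "j < dim_col (0\<^sub>m n n :: complex mat)"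
    thus "X $$ (i, j) = 0\<^sub>m n n $$ (i, j)"
      using X arg_cong[OF col, of j "\<lambda>v. v $ i"] by simp
  qed (use X in auto)
next
  assume "X = 0\<^sub>m n n"
  moreover have "op_norm n (0\<^sub>m n n) \<le> 0"
  proof (rule op_norm_le)
    fix v :: "complex vec" assume "v \<in> carrier_vec n"
    hence "0\<^sub>m n n *\<^sub>v v = 0\<^sub>v n" by (intro eq_vecI) auto
    thus "vnorm (0\<^sub>m n n *\<^sub>v v) \<le> 0" by simp
  qed
  ultimately show "op_norm n X = 0"
    using op_norm_nonneg[OF X] by simp
qed

lemma op_norm_smult_le:
  assumes X: "X \<in> carrier_mat n n"
  shows "op_norm n (c \<cdot>\<^sub>m X) \<le> cmod c * op_norm n X"
proof (rule op_norm_le)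
  fix v assume v: "v \<in> carrier_vec n" "vnorm v \<le> 1"
  have "(c \<cdot>\<^sub>m X) *\<^sub>v v = c \<cdot>\<^sub>v (X *\<^sub>v v)"
    using X v by (intro eq_vecI) auto
  thus "vnorm ((c \<cdot>\<^sub>m X) *\<^sub>v v) \<le> cmod c * op_norm n X"
    using vnorm_le_op_norm[OF X v] by (simp add: vnorm_smult mult_left_mono)
qed

text \<open>For \<open>c \<noteq> 0\<close> the reverse inequality is
  \<open>op_norm_smult_le\<close> applied to the scalar \<open>inverse c\<close> and the matrix
  \<open>c \<cdot>\<^sub>m X\<close>.\<close>

lemma op_norm_smult:
  assumes X: "X \<in> carrier_mat n n"
  shows "op_norm n (c \<cdot>\<^sub>m X) = cmod c * op_norm n X"
proof (cases "c = 0")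
  case True
  hence "c \<cdot>\<^sub>m X = 0\<^sub>m n n" using X by (intro eq_matI) auto
  with True show ?thesis by (simp add: op_norm_eq_0_iff)
next
  case False
  have "inverse c \<cdot>\<^sub>m (c \<cdot>\<^sub>m X) = X"
    using X False by (intro eq_matI) auto
  hence "op_norm n X \<le> cmod (inverse c) * op_norm n (c \<cdot>\<^sub>m X)"
    using op_norm_smult_le[of "c \<cdot>\<^sub>m X" n "inverse c"] X by simp
  hence "cmod c * op_norm n X \<le> op_norm n (c \<cdot>\<^sub>m X)"
    using False by (simp add: norm_divide field_simps)
  with op_norm_smult_le[OF X, of c] show ?thesis by simp
qed

lemma op_norm_add_le:
  assumes X: "X \<in> carrier_mat n n" and Y: "Y \<in> carrier_mat n n"
  shows "op_norm n (X + Y) \<le> op_norm n X + op_norm n Y"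
proof (rule op_norm_le)
  fix v assume v: "v \<in> carrier_vec n" "vnorm v \<le> 1"
  have "vnorm ((X + Y) *\<^sub>v v) \<le> vnorm (X *\<^sub>v v) + vnorm (Y *\<^sub>v v)"
    using X Y v by (simp add: add_mult_distrib_mat_vec[OF X Y] vnorm_add_le[of _ n])
  also have "\<dots> \<le> op_norm n X + op_norm n Y"
    using X Y v by (intro add_mono vnorm_le_op_norm)
  finally show "vnorm ((X + Y) *\<^sub>v v) \<le> op_norm n X + op_norm n Y" .
qed

text \<open>\<open>V\<close> maps the unit ball into itself and \<open>U\<close> preserves
  lengths.\<close>

lemma op_norm_unitary_le:
  assumes X: "X \<in> carrier_mat n n" and U: "unitary_mat n U" and V: "unitary_mat n V"
  shows "op_norm n (U * X * V) \<le> op_norm n X"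
proof (rule op_norm_le)
  fix v assume v: "v \<in> carrier_vec n" "vnorm v \<le> 1"
  have Uc: "U \<in> carrier_mat n n" and Vc: "V \<in> carrier_mat n n"
    using U V by (auto simp: unitary_mat_def)
  have "(U * X * V) *\<^sub>v v = U *\<^sub>v (X *\<^sub>v (V *\<^sub>v v))"
    using Uc Vc X v by (simp add: assoc_mult_mat_vec[of _ n n _ n] mult_carrier_mat[of _ n n])
  hence "vnorm ((U * X * V) *\<^sub>v v) = vnorm (X *\<^sub>v (V *\<^sub>v v))"
    using vnorm_unitary_mat[OF U, of "X *\<^sub>v (V *\<^sub>v v)"] X Vc v by simp
  also have "\<dots> \<le> op_norm n X"
    using X Vc v vnorm_unitary_mat[OF V v(1)] by (intro vnorm_le_op_norm) auto
  finally show "vnorm ((U * X * V) *\<^sub>v v) \<le> op_norm n X" .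
qed

lemma unitarily_invariant_op_norm: "unitarily_invariant_norm n (op_norm n)"
  unfolding unitarily_invariant_norm_def matrix_norm_def
proof (intro conjI ballI allI impI)
  fix X U V :: "complex mat"
  assume X: "X \<in> carrier_mat n n" and U: "unitary_mat n U" and V: "unitary_mat n V"
  define U' V' where "U' = mat_adjoint U" and "V' = mat_adjoint V"
  have UU: "U \<in> carrier_mat n n" "U' \<in> carrier_mat n n" "U' * U = 1\<^sub>m n"
    using U by (auto simp: unitary_mat_def U'_def)
  have VV: "V \<in> carrier_mat n n" "V' \<in> carrier_mat n n" "V * V' = 1\<^sub>m n"
    using V by (auto simp: unitary_mat_def V'_def)
  \<comment> \<open>Undoing \<open>U\<close> and \<open>V\<close> by their adjoints, which are
    unitary too, upgrades the one-sided estimate to an equality.\<close>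
  have "U' * (U * X * V) * V' = (U' * U) * (X * (V * V'))"
    using UU(1,2) VV(1,2) X by (simp add: assoc_mult_mat[of _ n n _ n _ n])
  also have "\<dots> = X" using UU VV X by simp
  finally have eq: "U' * (U * X * V) * V' = X" .
  have "U * X * V \<in> carrier_mat n n" using UU VV X by simp
  from op_norm_unitary_le[OF this, of U' V']
  have "op_norm n X \<le> op_norm n (U * X * V)"
    using eq U V by (simp add: U'_def V'_def unitary_mat_adjoint)
  with op_norm_unitary_le[OF X U V] show "op_norm n (U * X * V) = op_norm n X" by simp
qed (auto simp: op_norm_nonneg op_norm_eq_0_iff op_norm_smult op_norm_add_le)

section \<open>Real three by three matrices\<close>

text \<open>All matrices of the counterexample are real of size 3; this form reduces their products,
  sums and adjoints to rational arithmetic on nine entries.\<close>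

definition mat3 :: "real \<Rightarrow> real \<Rightarrow> real \<Rightarrow> real \<Rightarrow> real \<Rightarrow> real \<Rightarrow> real \<Rightarrow> real \<Rightarrow> real \<Rightarrow> complex mat" where
  "mat3 a b c d e f g h i = mat_of_rows_list 3
     [[of_real a, of_real b, of_real c], [of_real d, of_real e, of_real f],
      [of_real g, of_real h, of_real i]]"

lemma less_3_cases: "i < 3 \<Longrightarrow> i = 0 \<or> i = 1 \<or> i = (2 :: nat)"
  by auto

lemma sum_lessThan_3: "(\<Sum>i<3. f i) = f 0 + f 1 + f (2 :: nat)"
  by (simp add: eval_nat_numeral)

lemma mat3_carrier [simp]: "mat3 a b c d e f g h i \<in> carrier_mat 3 3"
  by (rule carrier_matI) (simp_all add: mat3_def mat_of_rows_list_def)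

lemma mat3_index:
  "mat3 a b c d e f g h i $$ (0, 0) = of_real a" "mat3 a b c d e f g h i $$ (0, Suc 0) = of_real b"
  "mat3 a b c d e f g h i $$ (0, 2) = of_real c" "mat3 a b c d e f g h i $$ (Suc 0, 0) = of_real d"
  "mat3 a b c d e f g h i $$ (Suc 0, Suc 0) = of_real e" "mat3 a b c d e f g h i $$ (Suc 0, 2) = of_real f"
  "mat3 a b c d e f g h i $$ (2, 0) = of_real g" "mat3 a b c d e f g h i $$ (2, Suc 0) = of_real h"
  "mat3 a b c d e f g h i $$ (2, 2) = of_real i"
  by (simp_all add: mat3_def mat_of_rows_list_def)

lemma eq_mat3I:
  assumes "X \<in> carrier_mat 3 3"
    and "X $$ (0, 0) = of_real a" "X $$ (0, Suc 0) = of_real b" "X $$ (0, 2) = of_real c"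
      "X $$ (Suc 0, 0) = of_real d" "X $$ (Suc 0, Suc 0) = of_real e" "X $$ (Suc 0, 2) = of_real f"
      "X $$ (2, 0) = of_real g" "X $$ (2, Suc 0) = of_real h" "X $$ (2, 2) = of_real i"
  shows "X = mat3 a b c d e f g h i"
proof (rule eq_matI)
  fix k l
  assume "k < dim_row (mat3 a b c d e f g h i)" "l < dim_col (mat3 a b c d e f g h i)"
  hence "k < 3" "l < 3"
    using carrier_matD[OF mat3_carrier, of a b c d e f g h i] by auto
  thus "X $$ (k, l) = mat3 a b c d e f g h i $$ (k, l)"
    using assms by (auto dest!: less_3_cases simp: mat3_index)
qed (use carrier_matD[OF assms(1)] carrier_matD[OF mat3_carrier, of a b c d e f g h i] in simp_all)

lemma mat3_mult:
  "mat3 a b c d e f g h i * mat3 a' b' c' d' e' f' g' h' i' =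
     mat3 (a * a' + b * d' + c * g') (a * b' + b * e' + c * h') (a * c' + b * f' + c * i')
          (d * a' + e * d' + f * g') (d * b' + e * e' + f * h') (d * c' + e * f' + f * i')
          (g * a' + h * d' + i * g') (g * b' + h * e' + i * h') (g * c' + h * f' + i * i')"
  (is "?X * ?Y = _")
proof -
  have "(?X * ?Y) $$ (k, l) = ?X $$ (k, 0) * ?Y $$ (0, l) + ?X $$ (k, 1) * ?Y $$ (1, l)
      + ?X $$ (k, 2) * ?Y $$ (2, l)" if "k < 3" "l < 3" for k l
    using that carrier_matD[OF mat3_carrier, of a b c d e f g h i]
      carrier_matD[OF mat3_carrier, of a' b' c' d' e' f' g' h' i']
    by (simp add: scalar_prod_def sum_lessThan_3 flip: lessThan_atLeast0)
  thus ?thesis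
    by (intro eq_mat3I mult_carrier_mat[OF mat3_carrier mat3_carrier]) (simp_all add: mat3_index)
qed

lemma mat3_add:
  "mat3 a b c d e f g h i + mat3 a' b' c' d' e' f' g' h' i' =
     mat3 (a + a') (b + b') (c + c') (d + d') (e + e') (f + f') (g + g') (h + h') (i + i')"
  by (intro eq_mat3I)
     (simp_all add: carrier_matD[OF mat3_carrier] mat3_index)

lemma mat3_minus:
  "mat3 a b c d e f g h i - mat3 a' b' c' d' e' f' g' h' i' =
     mat3 (a - a') (b - b') (c - c') (d - d') (e - e') (f - f') (g - g') (h - h') (i - i')"
  by (intro eq_mat3I)
     (simp_all add: carrier_matD[OF mat3_carrier] mat3_index minus_carrier_mat)

lemma mat_adjoint_mat3: "mat_adjoint (mat3 a b c d e f g h i) = mat3 a d g b e h c f i"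
  by (intro eq_mat3I mat_adjoint_carrier[OF mat3_carrier])
     (simp_all add: mat_adjoint_index[OF mat3_carrier] mat3_index)

lemma mat_diag_eq_mat3:
  "mat_diag 3 (\<lambda>i. complex_of_real (d i)) = mat3 (d 0) 0 0 0 (d 1) 0 0 0 (d 2)"
  by (intro eq_mat3I mat_diag_dim) (simp_all add: mat_diag_def)

lemma one_mat_eq_mat3: "1\<^sub>m 3 = mat3 1 0 0 0 1 0 0 0 1"
  by (intro eq_mat3I one_carrier_mat) simp_all

lemmas mat3_simps = mat3_mult mat3_add mat3_minus mat_adjoint_mat3 mat_diag_eq_mat3

text \<open>The hypothesis \<open>det\<close> is \<open>f\<close> times the nonnegativity of the determinant of the form.\<close>

lemma quadratic_form3_nonneg:
  fixes a b c d e f :: real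
  assumes f: "0 < f" and df: "0 < d * f - e\<^sup>2"
    and det: "(b * f - c * e)\<^sup>2 \<le> (a * f - c\<^sup>2) * (d * f - e\<^sup>2)"
  shows "0 \<le> a * x\<^sup>2 + d * y\<^sup>2 + f * z\<^sup>2 + 2 * b * x * y + 2 * c * x * z + 2 * e * y * z"
    (is "0 \<le> ?q")
proof -
  \<comment> \<open>Completing the square in \<open>z\<close> leaves the binary form with
    coefficients \<open>k\<close>, \<open>2 * l\<close>, \<open>m\<close>, which is \<open>f\<close>
    times the Schur complement; completing the square in \<open>y\<close> then shows that it is
    nonnegative.\<close>
  define k l m where "k = a * f - c\<^sup>2" and "l = b * f - c * e" and "m = d * f - e\<^sup>2"
  have "m * (k * x\<^sup>2 + 2 * l * x * y + m * y\<^sup>2) = (m * y + l * x)\<^sup>2 + (k * m - l\<^sup>2) * x\<^sup>2"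
    by (simp add: power2_eq_square algebra_simps)
  also have "0 \<le> \<dots>"
    using det by (simp add: k_def l_def m_def)
  finally have "0 \<le> k * x\<^sup>2 + 2 * l * x * y + m * y\<^sup>2"
    using df by (simp add: m_def zero_le_mult_iff)
  moreover have "f * ?q = (f * z + c * x + e * y)\<^sup>2 + (k * x\<^sup>2 + 2 * l * x * y + m * y\<^sup>2)"
    by (simp add: k_def l_def m_def power2_eq_square algebra_simps)
  ultimately have "0 \<le> f * ?q"
    by simp
  thus ?thesis
    using f by (simp add: zero_le_mult_iff)
qed

text \<open>A real matrix acts separately on the real and imaginary parts of a vector, so the real
  estimate \<open>q\<close> is used for each part and the two are added.\<close>

lemma op_norm_mat3_le:
  assumes t: "0 \<le> t"
    and q: "\<And>x y z. (a * x + b * y + c * z)\<^sup>2 + (d * x + e * y + f * z)\<^sup>2 + (g * x + h * y + i * z)\<^sup>2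
      \<le> t\<^sup>2 * (x\<^sup>2 + y\<^sup>2 + z\<^sup>2)"
  shows "op_norm 3 (mat3 a b c d e f g h i) \<le> t"
proof (rule op_norm_le)
  fix v :: "complex vec" assume v: "v \<in> carrier_vec 3" "vnorm v \<le> 1"
  let ?X = "mat3 a b c d e f g h i" and ?re = "\<lambda>i. Re (v $ i)" and ?im = "\<lambda>i. Im (v $ i)"
  have X: "dim_row ?X = 3" "dim_col ?X = 3"
    using carrier_matD[OF mat3_carrier] by auto
  have Xv: "(?X *\<^sub>v v) $ k = ?X $$ (k, 0) * v $ 0 + ?X $$ (k, 1) * v $ 1 + ?X $$ (k, 2) * v $ 2"
    if "k < 3" for k
    using that v X by (simp add: scalar_prod_def sum_lessThan_3 flip: lessThan_atLeast0)
  have "(vnorm (?X *\<^sub>v v))\<^sup>2 =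
      ((a * ?re 0 + b * ?re 1 + c * ?re 2)\<^sup>2 + (d * ?re 0 + e * ?re 1 + f * ?re 2)\<^sup>2
        + (g * ?re 0 + h * ?re 1 + i * ?re 2)\<^sup>2)
      + ((a * ?im 0 + b * ?im 1 + c * ?im 2)\<^sup>2 + (d * ?im 0 + e * ?im 1 + f * ?im 2)\<^sup>2
        + (g * ?im 0 + h * ?im 1 + i * ?im 2)\<^sup>2)"
    by (simp add: vnorm_sq X sum_lessThan_3 Xv mat3_index cmod_power2 del: index_mult_mat_vec)
  also have "\<dots> \<le> t\<^sup>2 * ((?re 0)\<^sup>2 + (?re 1)\<^sup>2 + (?re 2)\<^sup>2) + t\<^sup>2 * ((?im 0)\<^sup>2 + (?im 1)\<^sup>2 + (?im 2)\<^sup>2)"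
    by (intro add_mono q)
  also have "\<dots> = (t * vnorm v)\<^sup>2"
    using v by (simp add: power_mult_distrib vnorm_sq sum_lessThan_3 cmod_power2 algebra_simps)
  finally have "vnorm (?X *\<^sub>v v) \<le> t * vnorm v"
    using t by (auto intro: power2_le_imp_le)
  also have "\<dots> \<le> t"
    using t v by (simp add: mult_left_le)
  finally show "vnorm (?X *\<^sub>v v) \<le> t" .
qed

section \<open>The counterexample\<close>

definition kink :: "real \<Rightarrow> real" where
  "kink x = 10 * x + max (x - 154) 0"

text \<open>The columns of \<open>frameB\<close> and \<open>frameC\<close> are eigenvectors of \<open>B\<close> and \<open>B + \<Delta>\<close>.\<close>

definition frameB :: "complex mat" where
  "frameB = mat3 (1/17) (12/17) (12/17) (12/17) (-9/17) (8/17) (12/17) (8/17) (-9/17)"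

definition frameC :: "complex mat" where
  "frameC = mat3 0 (3/5) (4/5) (3/5) (-16/25) (12/25) (4/5) (12/25) (-9/25)"

definition diag3 :: "real \<Rightarrow> real \<Rightarrow> real \<Rightarrow> nat \<Rightarrow> real" where
  "diag3 a b c i = (if i = 0 then a else if i = 1 then b else c)"

lemma convex_on_kink: "convex_on {0..} kink"
proof -
  have "convex_on {0..} (\<lambda>x::real. max (x - 154) 0)"
  proof (rule convex_onI)
    fix t x y :: real assume t: "0 < t" "t < 1"
    \<comment> \<open>The first two bounds serve the case where the maximum on the left is its first
      argument, the last two the case where it is 0.\<close>
    have "(1 - t) * (x - 154) \<le> (1 - t) * max (x - 154) 0" "t * (y - 154) \<le> t * max (y - 154) 0"
      "0 \<le> (1 - t) * max (x - 154) 0" "0 \<le> t * max (y - 154) 0"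
      using t by (simp_all add: mult_left_mono)
    moreover have "(1 - t) * x + t * y - 154 = (1 - t) * (x - 154) + t * (y - 154)"
      by (simp add: algebra_simps)
    ultimately show "max ((1 - t) *\<^sub>R x + t *\<^sub>R y - 154) 0
        \<le> (1 - t) * max (x - 154) 0 + t * max (y - 154) 0"
      by simp
  qed simp
  moreover have "convex_on {0..} (\<lambda>x::real. 10 * x)"
    by (rule convex_onI) (simp_all add: algebra_simps)
  ultimately show ?thesis
    unfolding kink_def by (intro convex_on_add)
qed

lemma unitary_frameB: "unitary_mat 3 frameB"
  by (simp add: unitary_mat_def frameB_def one_mat_eq_mat3 mat3_simps)

lemma unitary_frameC: "unitary_mat 3 frameC"
  by (simp add: unitary_mat_def frameC_def one_mat_eq_mat3 mat3_simps)

theorem mainTheorem7: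
  shows "\<exists>(n :: nat) (B :: complex mat) (\<Delta> :: complex mat)
            (N :: complex mat \<Rightarrow> real) (g :: real \<Rightarrow> real).
           psd_mat n B \<and> psd_mat n \<Delta> \<and>
           unitarily_invariant_norm n N \<and>
           (\<forall>x \<ge> 0. 0 \<le> g x) \<and> mono_on {0..} g \<and> convex_on {0..} g \<and> g 0 = 0 \<and>
           N (spectral_calculus g (B + \<Delta>) - spectral_calculus g B)
             < N (spectral_calculus g \<Delta>)"
proof (intro exI conjI)
  \<comment> \<open>The eigenvalues are 50, -154, -35 for \<open>?B\<close> and 70, -125, 0 for
    \<open>?C\<close>, each shifted by 154. Only one of each exceeds 154, so the nonlinear part of
    \<open>kink\<close> contributes 70 times the projection onto the first column of
    \<open>frameC\<close> minus 50 times the projection onto the first column of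
    \<open>frameB\<close>.\<close>
  let ?B = "frameB * mat_diag 3 (\<lambda>i. complex_of_real (diag3 204 0 119 i)) * mat_adjoint frameB"
  let ?C = "frameC * mat_diag 3 (\<lambda>i. complex_of_real (diag3 224 29 154 i)) * mat_adjoint frameC"
  let ?I = "mat3 1 0 0 0 1 0 0 0 1"
  \<comment> \<open>Conjugation by the identity puts the diagonal matrix in the form that
    \<open>psd_mat_unitary_diag\<close> and \<open>spectral_calculus_eqI\<close> expect.\<close>
  let ?D = "?I * mat_diag 3 (\<lambda>i. complex_of_real (diag3 49 0 35 i)) * mat_adjoint ?I"
  have I: "unitary_mat 3 ?I"
    by (simp add: unitary_mat_def one_mat_eq_mat3 mat3_simps)
  show "psd_mat 3 ?B"
    by (rule psd_mat_unitary_diag[OF unitary_frameB]) (simp add: diag3_def)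
  show "psd_mat 3 ?D"
    by (rule psd_mat_unitary_diag[OF I]) (simp add: diag3_def)
  show "unitarily_invariant_norm 3 (op_norm 3)"
    by (rule unitarily_invariant_op_norm)
  show "\<forall>x\<ge>0. 0 \<le> kink x" "mono_on {0..} kink" "kink 0 = 0"
    by (auto simp: kink_def mono_on_def)
  show "convex_on {0..} kink"
    by (rule convex_on_kink)
  \<comment> \<open>The six eigenvalues are fitted to the two frames so that this holds; it supplies
    the spectral decomposition of the sum.\<close>
  have BD: "?B + ?D = ?C"
    by (simp add: frameB_def frameC_def mat3_simps diag3_def)
  have gB: "spectral_calculus kink ?B =
      frameB * mat_diag 3 (\<lambda>i. complex_of_real (kink (diag3 204 0 119 i))) * mat_adjoint frameB"
    by (rule spectral_calculus_eqI[OF unitary_frameB refl])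
  have gC: "spectral_calculus kink (?B + ?D) =
      frameC * mat_diag 3 (\<lambda>i. complex_of_real (kink (diag3 224 29 154 i))) * mat_adjoint frameC"
    unfolding BD by (rule spectral_calculus_eqI[OF unitary_frameC refl])
  \<comment> \<open>The top left entry is \<open>490 - 50/289\<close>.\<close>
  have diff: "spectral_calculus kink (?B + ?D) - spectral_calculus kink ?B =
      mat3 (707800/1445) (-3000/1445) (-3000/1445) (-3000/1445) (414/1445) (12552/1445)
        (-3000/1445) (12552/1445) (534486/1445)"
    unfolding gB gC
    unfolding mat_diag_eq_mat3 frameB_def frameC_def by (simp add: mat3_simps diag3_def kink_def)
  \<comment> \<open>All eigenvalues of \<open>?D\<close> lie below 154, where \<open>kink\<close> is
    multiplication by 10.\<close>
  have "spectral_calculus kink ?D =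
      ?I * mat_diag 3 (\<lambda>i. complex_of_real (kink (diag3 49 0 35 i))) * mat_adjoint ?I"
    by (rule spectral_calculus_eqI[OF I refl])
  also have "\<dots> = mat3 490 0 0 0 0 0 0 0 350"
    unfolding mat_diag_eq_mat3 by (simp add: mat3_simps diag3_def kink_def)
  finally have gD: "spectral_calculus kink ?D = mat3 490 0 0 0 0 0 0 0 350" .
  \<comment> \<open>In units of 1/1445 the top left entry is 707800 and the target 490 is 708050.
    The off-diagonal entries lift the largest eigenvalue above 707800 by only about 67, so 707906
    leaves room on both sides.\<close>
  have "op_norm 3 (spectral_calculus kink (?B + ?D) - spectral_calculus kink ?B) \<le> 707906/1445"
    unfolding diff
  proof (rule op_norm_mat3_le)
    fix x y z :: real
    show "(707800/1445 * x + -3000/1445 * y + -3000/1445 * z)\<^sup>2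
        + (-3000/1445 * x + 414/1445 * y + 12552/1445 * z)\<^sup>2
        + (-3000/1445 * x + 12552/1445 * y + 534486/1445 * z)\<^sup>2
        \<le> (707906/1445)\<^sup>2 * (x\<^sup>2 + y\<^sup>2 + z\<^sup>2)"
      \<comment> \<open>With \<open>M\<close> denoting 1445 times the difference matrix, the numbers
        are the entries of 707906^2 times the identity minus M^2, listed in the order
        \<open>f\<close>, \<open>d\<close>, \<open>e\<close>, \<open>b\<close>, \<open>c\<close>,
        \<open>a\<close>.\<close>
      using quadratic_form3_nonneg[of 215289067936 500964180736 "-6723064800" 2162298000 3764514000 132064836 x y z]
      by (simp add: power2_eq_square field_simps)
  qed simp
  also have "707906/1445 < (490 :: real)" by simp
  \<comment> \<open>The first unit vector is an eigenvector for the eigenvalue 490 and has length 1,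
    so it witnesses the lower bound.\<close>
  also have "490 \<le> op_norm 3 (spectral_calculus kink ?D)"
  proof -
    have "mat3 490 0 0 0 0 0 0 0 350 *\<^sub>v unit_vec 3 0 = 490 \<cdot>\<^sub>v unit_vec 3 0"
      using carrier_matD[OF mat3_carrier, of 490 0 0 0 0 0 0 0 350]
      by (intro eq_vecI) (auto dest!: less_3_cases simp: mat3_index)
    thus ?thesis
      unfolding gD
      using vnorm_le_op_norm[OF mat3_carrier, of "unit_vec 3 0" 490 0 0 0 0 0 0 0 350]
      by (simp add: vnorm_smult vnorm_unit_vec)
  qed
  finally show "op_norm 3 (spectral_calculus kink (?B + ?D) - spectral_calculus kink ?B)
      < op_norm 3 (spectral_calculus kink ?D)" .
qed

end
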